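(* The $3$-sphere admits $2^{\Omega(n^2)}$ combinatorially distinct triangulations on $n$ vertices. That is, there exist a constant $c>0$ and an integer $n_0$ such that for every $n \geq n_0$ there are at least $2^{c n^2}$ pairwise combinatorially distinct triangulations of the $3$-sphere with $n$ vertices.
   Context: A triangulation of the $3$-sphere with $n$ vertices is a finite simplicial complex with exactly $n$ vertices whose geometric realization is homeomorphic to the $3$-sphere. Two triangulations are combinatorially distinct if they are not isomorphic as abstract simplicial complexes. *)

theory Defs
  imports "HOL-Analysis.Analysis"
begin

(* The empty set is not counted as a face, and the vertices are the elements of
   the faces. (The library's simplicial_complex in Polytope.thy is the geometric
   notion, tied to a fixed ambient Euclidean space.) *)
definition finite_abstract_complex :: "'a set set \<Rightarrow> bool" where
  "finite_abstract_complex K \<longleftrightarrow>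
     finite K \<and>
     (\<forall>\<sigma>\<in>K. finite \<sigma> \<and> \<sigma> \<noteq> {}) \<and>
     (\<forall>\<sigma>\<in>K. \<forall>\<tau>. \<tau> \<subseteq> \<sigma> \<and> \<tau> \<noteq> {} \<longrightarrow> \<tau> \<in> K)"

definition vertices :: "'a set set \<Rightarrow> 'a set" where
  "vertices K = \<Union>K"

(* Points are given by their barycentric coordinates. The function space carries the
   product topology; since all points vanish outside the vertices, for a finite
   complex this is the Euclidean topology on the vertex coordinates. *)
definition geometric_realization :: "'a set set \<Rightarrow> ('a \<Rightarrow> real) set" where
  "geometric_realization K =
     {x. (\<forall>v. 0 \<le> x v) \<and> {v. x v \<noteq> 0} \<in> K \<and> (\<Sum>v | x v \<noteq> 0. x v) = 1}"

definition complex_isomorphic :: "'a set set \<Rightarrow> 'b set set \<Rightarrow> bool" where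
  "complex_isomorphic K L \<longleftrightarrow>
     (\<exists>f. bij_betw f (vertices K) (vertices L) \<and>
          (\<forall>\<sigma>. \<sigma> \<subseteq> vertices K \<longrightarrow> (\<sigma> \<in> K \<longleftrightarrow> f ` \<sigma> \<in> L)))"

definition sphere3_triangulation :: "nat \<Rightarrow> 'a set set \<Rightarrow> bool" where
  "sphere3_triangulation n K \<longleftrightarrow>
     finite_abstract_complex K \<and>
     card (vertices K) = n \<and>
     geometric_realization K homeomorphic sphere (0 :: real ^ 4) 1"

end

theory Submission
  imports Defs
begin

text \<open>The join of a path \<open>a(0), \<dots>, a(m)\<close> with a path \<open>b(0), \<dots>, b(n)\<close> is a
  triangulated 3-ball whose tetrahedra \<open>a(i) a(i+1) b(j) b(j+1)\<close> correspond to the cells of an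
  \<open>m \<times> n\<close> grid, two of them sharing a triangle when the cells are adjacent. Coning the boundary
  gives a 3-sphere. In the grid, the diagonals \<open>i + j \<in> {3k + 1, 3k + 2}\<close> form a strip, a stacked
  ball, which is replaced by the cone over its boundary with a new apex \<open>o(k)\<close>. A cell on the
  diagonal \<open>i + j = 3k\<close> now meets the \<open>k\<close>-th cone in two triangles, so a 3-2 flip absorbs it
  into that cone. These flips are independent of each other, and their number is quadratic in the
  number of vertices, so performing an arbitrary subset of them beats the factorial bound on the
  size of an isomorphism class. Every step, from the boundary of the 4-simplex on, is a
  bistellar move, and these are realized by explicit homeomorphisms.\<close>

section \<open>Bistellar moves\<close>

definition faces :: "'a set set \<Rightarrow> 'a set set" where
  "faces \<Phi> = {\<sigma>. \<sigma> \<noteq> {} \<and> (\<exists>F\<in>\<Phi>. \<sigma> \<subseteq> F)}"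

lemma vertices_faces: "vertices (faces \<Phi>) = \<Union>\<Phi>"
  unfolding vertices_def faces_def by blast

lemma finite_abstract_complex_faces:
  assumes "finite (\<Union>\<Phi>)"
  shows "finite_abstract_complex (faces \<Phi>)"
proof -
  have "faces \<Phi> \<subseteq> Pow (\<Union>\<Phi>)" unfolding faces_def by blast
  with assms have "finite (faces \<Phi>)" and "\<forall>\<sigma>\<in>faces \<Phi>. finite \<sigma>"
    by (auto intro: finite_subset)
  then show ?thesis
    unfolding finite_abstract_complex_def faces_def by blast
qed

text \<open>Coordinates outside the support add nothing, so weight may be summed over any facet
  containing the support, and total weight one makes the support nonempty. It then suffices to
  exhibit a facet rather than the exact support.\<close>

lemma geometric_realization_faces:
  assumes "\<forall>F\<in>\<Phi>. finite F"
  shows "x \<in> geometric_realization (faces \<Phi>) \<longleftrightarrow>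
    (\<forall>v. 0 \<le> x v) \<and> (\<exists>F\<in>\<Phi>. {v. x v \<noteq> 0} \<subseteq> F \<and> sum x F = 1)"
proof -
  have 1: "sum x {v. x v \<noteq> 0} = sum x F" if "F \<in> \<Phi>" "{v. x v \<noteq> 0} \<subseteq> F" for F
    using that assms by (intro sum.mono_neutral_left) auto
  have 2: "{v. x v \<noteq> 0} \<noteq> {}" if "sum x F = 1" for F
  proof
    assume "{v. x v \<noteq> 0} = {}"
    then have "sum x F = 0" by (intro sum.neutral) blast
    with that show False by simp
  qed
  show ?thesis (is "?l \<longleftrightarrow> ?r")
  proof
    assume "x \<in> geometric_realization (faces \<Phi>)"
    then have x: "\<forall>v. 0 \<le> x v" "{v. x v \<noteq> 0} \<in> faces \<Phi>" "sum x {v. x v \<noteq> 0} = 1"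
      unfolding geometric_realization_def by simp_all
    from x(2) have "\<exists>F\<in>\<Phi>. {v. x v \<noteq> 0} \<subseteq> F" unfolding faces_def by simp
    then obtain F where F: "F \<in> \<Phi>" "{v. x v \<noteq> 0} \<subseteq> F" by (elim bexE)
    then show ?r using x(1) x(3)[unfolded 1[OF F]] by (intro conjI bexI[of _ F])
  next
    assume ?r
    then obtain F where F: "F \<in> \<Phi>" "{v. x v \<noteq> 0} \<subseteq> F" "sum x F = 1" and x0: "\<forall>v. 0 \<le> x v"
      by (elim conjE bexE)
    have "{v. x v \<noteq> 0} \<in> faces \<Phi>"
      unfolding faces_def using 2[OF F(3)] F(1,2) by blast
    then show ?l
      unfolding geometric_realization_def
      by (intro CollectI conjI x0) (simp_all add: 1[OF F(1,2)] F(3))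
  qed
qed

section \<open>Homeomorphisms realizing bistellar moves\<close>

lemma continuous_on_Min_coordinates:
  fixes A :: "'a set"
  assumes "finite A" "A \<noteq> {}"
  shows "continuous_on S (\<lambda>x :: 'a \<Rightarrow> real. Min (x ` A))"
  using assms
proof (induction rule: finite_ne_induct)
  case (singleton a)
  then show ?case by (simp add: continuous_on_subset[OF continuous_on_product_coordinates])
next
  case (insert a A)
  have "(\<lambda>x :: 'a \<Rightarrow> real. Min (x ` insert a A)) = (\<lambda>x. min (x a) (Min (x ` A)))"
    using insert by (simp add: fun_eq_iff)
  then show ?case
    using insert by (auto intro!: continuous_on_min continuous_on_subset[OF continuous_on_product_coordinates])
qed

text \<open>In the support of a point, a bistellar move trades the smallest weight on \<open>A\<close> for
  weight on \<open>B\<close>; the reverse move undoes this because \<open>B\<close> itself is not a face before the move.\<close>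

definition weight_shift :: "'a set \<Rightarrow> 'a set \<Rightarrow> ('a \<Rightarrow> real) \<Rightarrow> 'a \<Rightarrow> real" where
  "weight_shift A B x = (\<lambda>v. x v - (if v \<in> A then Min (x ` A) else 0)
     + (if v \<in> B then Min (x ` A) * card A / card B else 0))"

lemma continuous_on_weight_shift:
  assumes "finite A" "A \<noteq> {}"
  shows "continuous_on S (weight_shift A B)"
proof (rule continuous_on_coordinatewise_then_product)
  fix v
  show "continuous_on S (\<lambda>x. weight_shift A B x v)"
    unfolding weight_shift_def using assms
    by (cases "v \<in> A"; cases "v \<in> B")
       (auto simp: divide_inverse intro!: continuous_intros continuous_on_Min_coordinates
         continuous_on_subset[OF continuous_on_product_coordinates])
qed

text \<open>The star of \<open>A\<close> is the join of \<open>A\<close> with the boundary of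
  \<open>B\<close>; the move replaces it by the join of the boundary of \<open>A\<close> with
  \<open>B\<close>, which must be a missing face beforehand. For a singleton \<open>B\<close> its
  vertex is new.\<close>

definition bistellar :: "'a set \<Rightarrow> 'a set \<Rightarrow> 'a set set \<Rightarrow> 'a set set \<Rightarrow> bool" where
  "bistellar A B \<Phi> \<Psi> \<longleftrightarrow> A \<noteq> {} \<and> B \<noteq> {} \<and> finite A \<and> finite B \<and> A \<inter> B = {} \<and>
     (\<forall>F\<in>\<Phi>. finite F \<and> \<not> B \<subseteq> F) \<and>
     {F \<in> \<Phi>. A \<subseteq> F} = (\<lambda>b. A \<union> (B - {b})) ` B \<and>
     \<Psi> = {F \<in> \<Phi>. \<not> A \<subseteq> F} \<union> (\<lambda>a. B \<union> (A - {a})) ` A"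

text \<open>All inserted facets contain \<open>B\<close> and no old one does, so the facets of
  \<Psi> without \<open>B\<close> are exactly those of \<Phi> without \<open>A\<close>.\<close>

lemma bistellar_sym:
  assumes "bistellar A B \<Phi> \<Psi>"
  shows "bistellar B A \<Psi> \<Phi>"
proof -
  have AB: "A \<noteq> {}" "B \<noteq> {}" "finite A" "finite B" "A \<inter> B = {}"
    and \<Phi>: "\<And>F. F \<in> \<Phi> \<Longrightarrow> finite F" "\<And>F. F \<in> \<Phi> \<Longrightarrow> \<not> B \<subseteq> F"
    and star: "{F \<in> \<Phi>. A \<subseteq> F} = (\<lambda>b. A \<union> (B - {b})) ` B"
    and \<Psi>: "\<Psi> = {F \<in> \<Phi>. \<not> A \<subseteq> F} \<union> (\<lambda>a. B \<union> (A - {a})) ` A"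
    using assms unfolding bistellar_def by auto
  have not_A: "\<not> A \<subseteq> B \<union> (A - {a})" if "a \<in> A" for a using that AB(5) by blast
  have no_B: "{F \<in> \<Psi>. \<not> B \<subseteq> F} = {F \<in> \<Phi>. \<not> A \<subseteq> F}"
    using \<Phi>(2) unfolding \<Psi> by auto
  moreover have "\<Phi> = {F \<in> \<Phi>. \<not> A \<subseteq> F} \<union> {F \<in> \<Phi>. A \<subseteq> F}" by auto
  ultimately have "\<Phi> = {F \<in> \<Psi>. \<not> B \<subseteq> F} \<union> (\<lambda>b. A \<union> (B - {b})) ` B"
    unfolding star by simp
  moreover have "{F \<in> \<Psi>. B \<subseteq> F} = (\<lambda>a. B \<union> (A - {a})) ` A"
    using \<Phi>(2) unfolding \<Psi> by auto
  moreover have "\<forall>F\<in>\<Psi>. finite F \<and> \<not> A \<subseteq> F"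
    using \<Phi>(1) AB not_A unfolding \<Psi> by auto
  ultimately show ?thesis using AB unfolding bistellar_def by (simp add: Int_commute)
qed

lemma weight_shift_bistellar:
  assumes "bistellar A B \<Phi> \<Psi>" and x: "x \<in> geometric_realization (faces \<Phi>)"
  shows "weight_shift A B x \<in> geometric_realization (faces \<Psi>)"
    and "weight_shift B A (weight_shift A B x) = x"
proof -
  have AB: "A \<noteq> {}" "B \<noteq> {}" "finite A" "finite B" "A \<inter> B = {}"
    and \<Phi>: "\<And>F. F \<in> \<Phi> \<Longrightarrow> finite F" "\<And>F. F \<in> \<Phi> \<Longrightarrow> \<not> B \<subseteq> F"
    and star: "{F \<in> \<Phi>. A \<subseteq> F} = (\<lambda>b. A \<union> (B - {b})) ` B"
    and \<Psi>: "\<Psi> = {F \<in> \<Phi>. \<not> A \<subseteq> F} \<union> (\<lambda>a. B \<union> (A - {a})) ` A"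
    using assms(1) unfolding bistellar_def by auto
  have fA: "finite A" "A \<noteq> {}" and fB: "finite B" "B \<noteq> {}" and dis: "A \<inter> B = {}"
    using AB by auto
  have f: "\<forall>F\<in>\<Phi>. finite F" "\<forall>F\<in>\<Psi>. finite F"
    using \<Phi>(1) AB unfolding \<Psi> by auto
  obtain F where x0: "\<And>v. 0 \<le> x v" and F: "F \<in> \<Phi>" "{v. x v \<noteq> 0} \<subseteq> F" "sum x F = 1"
    using iffD1[OF geometric_realization_faces[OF f(1)] x] by auto
  define t where "t = Min (x ` A)"
  have "t \<in> x ` A" unfolding t_def using fA by (intro Min_in) auto
  then obtain a0 where a0: "a0 \<in> A" "x a0 = t" by auto
  have tle: "t \<le> x v" if "v \<in> A" for v unfolding t_def using fA that by auto
  have t0: "0 \<le> t" using x0 a0 by metis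
  \<comment> \<open>No facet contains \<open>B\<close>, so some coordinate on \<open>B\<close>
    vanishes. After the shift the minimum over \<open>B\<close> is therefore exactly
    \<open>u\<close>, from which the reverse shift recovers \<open>t\<close>.\<close>
  obtain b0 where b0: "b0 \<in> B" "x b0 = 0"
    using \<Phi>(2)[OF F(1)] F(2) by auto
  define u where "u = t * card A / card B"
  have u0: "0 \<le> u" unfolding u_def using t0 by simp
  let ?y = "weight_shift A B x"
  have y: "?y v = (if v \<in> A then x v - t else if v \<in> B then x v + u else x v)" for v
    using dis unfolding weight_shift_def t_def u_def by auto
  have "Min (?y ` B) = u"
    by (rule Min_eqI) (use fB b0 dis x0 u0 y in \<open>auto intro!: image_eqI[of _ _ b0]\<close>)
  moreover have "u * card B / card A = t"
    unfolding u_def using fA fB by (simp add: card_gt_0_iff)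
  ultimately show "weight_shift B A ?y = x"
    using dis y unfolding weight_shift_def[of B A ?y] by (auto simp: fun_eq_iff)
  have y0: "0 \<le> ?y v" for v using y tle x0 u0 by (auto simp: add_nonneg_nonneg)
  have "\<exists>G\<in>\<Psi>. {v. ?y v \<noteq> 0} \<subseteq> G \<and> sum ?y G = 1"
  \<comment> \<open>For \<open>t = 0\<close> the map fixes \<open>x\<close>; if \<open>F\<close>
    contains \<open>A\<close>, it can be exchanged for \<open>B \<union> (A - {a0})\<close> because
    \<open>a0\<close> has weight zero. For \<open>t > 0\<close> the support contains
    \<open>A\<close>, and subtracting \<open>t\<close> clears \<open>a0\<close>, which leads to the
    same facet.\<close>
  proof (cases "t = 0")
    case True
    then have yx: "?y = x" using y u_def by auto
    show ?thesis
    proof (cases "A \<subseteq> F")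
      case False
      then have "F \<in> \<Psi>" using F unfolding \<Psi> by auto
      then show ?thesis using F yx by auto
    next
      case AF: True
      then have "F \<in> (\<lambda>b. A \<union> (B - {b})) ` B" using F(1) star by auto
      then obtain b where b: "b \<in> B" "F = A \<union> (B - {b})" by auto
      let ?G = "B \<union> (A - {a0})"
      have sub: "{v. x v \<noteq> 0} \<subseteq> ?G" using F b a0 True by auto
      have G: "?G \<in> \<Psi>" using a0 unfolding \<Psi> by auto
      have "sum x ?G = sum x {v. x v \<noteq> 0}"
        using sub f(2) G by (intro sum.mono_neutral_right) auto
      also have "\<dots> = sum x F"
        using F f(1) by (intro sum.mono_neutral_left) auto
      finally show ?thesis using yx sub G F by metis
    qed
  next
    case False
    then have tp: "0 < t" using t0 by simp
    have "A \<subseteq> F"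
    proof
      fix v assume "v \<in> A"
      then have "x v \<noteq> 0" using tle[of v] tp by auto
      then show "v \<in> F" using F by auto
    qed
    then have "F \<in> (\<lambda>b. A \<union> (B - {b})) ` B" using F(1) star by auto
      then obtain b where b: "b \<in> B" "F = A \<union> (B - {b})" by auto
    let ?G = "B \<union> (A - {a0})"
    have sub: "{v. ?y v \<noteq> 0} \<subseteq> ?G"
    proof
      fix v assume "v \<in> {v. ?y v \<noteq> 0}"
      then show "v \<in> ?G"
        using y[of v] F b a0 by (auto split: if_splits)
    qed
    have G: "?G \<in> \<Psi>" using a0 unfolding \<Psi> by auto
    have "sum ?y ?G = sum ?y (A \<union> B)"
      using fA fB y a0 dis by (intro sum.mono_neutral_left) auto
    also have "\<dots> = sum ?y A + sum ?y B" using fA fB dis by (simp add: sum.union_disjoint)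
    also have "sum ?y A = sum x A - card A * t"
      using y by (simp add: sum_subtractf)
    also have "sum ?y B = sum x B + card B * u"
    proof -
      have "sum ?y B = (\<Sum>v\<in>B. x v + u)" using y dis by (intro sum.cong) auto
      then show ?thesis by (simp add: sum.distrib)
    qed
    \<comment> \<open>The weight taken from \<open>A\<close> equals the weight given to
      \<open>B\<close>, by the choice of \<open>u\<close>.\<close>
    also have "sum x A - card A * t + (sum x B + card B * u) = sum x A + sum x B"
      using fB unfolding u_def by (simp add: card_gt_0_iff)
    also have "\<dots> = sum x (A \<union> B)" using fA fB dis by (simp add: sum.union_disjoint)
    also have "\<dots> = sum x F"
      using fA fB b F by (intro sum.mono_neutral_right) auto
    finally show ?thesis using sub G F by metis
  qed
  then show "?y \<in> geometric_realization (faces \<Psi>)"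
    using y0 by (intro iffD2[OF geometric_realization_faces[OF f(2)]] conjI allI)
qed

lemma homeomorphic_by_inverses:
  assumes "\<And>x. x \<in> S \<Longrightarrow> f x \<in> T" "\<And>x. x \<in> S \<Longrightarrow> g (f x) = x"
    and "\<And>y. y \<in> T \<Longrightarrow> g y \<in> S" "\<And>y. y \<in> T \<Longrightarrow> f (g y) = y"
    and "continuous_on S f" "continuous_on T g"
  shows "S homeomorphic T"
proof (rule homeomorphicI[where f = f and g = g])
  show "f ` S = T" using assms(1,3,4) by (metis image_eqI image_subsetI subsetI subset_antisym)
  show "g ` T = S" using assms(1,2,3) by (metis image_eqI image_subsetI subsetI subset_antisym)
qed (use assms in auto)

lemma bistellar_homeomorphic:
  assumes "bistellar A B \<Phi> \<Psi>"
  shows "geometric_realization (faces \<Phi>) homeomorphic geometric_realization (faces \<Psi>)"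
proof -
  note s = bistellar_sym[OF assms]
  have AB: "finite A" "A \<noteq> {}" "finite B" "B \<noteq> {}" using assms unfolding bistellar_def by auto
  show ?thesis
    by (rule homeomorphic_by_inverses[OF weight_shift_bistellar[OF assms]
          weight_shift_bistellar[OF s] continuous_on_weight_shift[OF AB(1,2)]
          continuous_on_weight_shift[OF AB(3,4)]])
qed

text \<open>Points are extended by zero to the labels outside the range of \<open>g\<close>;
  composing with \<open>g\<close> undoes this.\<close>

lemma geometric_realization_relabel:
  fixes g :: "'a \<Rightarrow> 'b"
  assumes g: "inj g" and f: "\<forall>F\<in>\<Phi>. finite F"
  shows "geometric_realization (faces \<Phi>) homeomorphic geometric_realization (faces ((`) g ` \<Phi>))"
proof -
  let ?p = "\<lambda>(x :: 'a \<Rightarrow> real) w. if w \<in> range g then x (inv g w) else 0"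
  let ?q = "\<lambda>(y :: 'b \<Rightarrow> real) v. y (g v)"
  have f': "\<forall>F\<in>(`) g ` \<Phi>. finite F" using f by auto
  note r = geometric_realization_faces[OF f] geometric_realization_faces[OF f']
  have p: "?p x \<in> geometric_realization (faces ((`) g ` \<Phi>))"
    if xin: "x \<in> geometric_realization (faces \<Phi>)" for x
  proof -
    obtain F where F: "F \<in> \<Phi>" "{v. x v \<noteq> 0} \<subseteq> F" "sum x F = 1" and x0: "\<forall>v. 0 \<le> x v"
      using iffD1[OF r(1) xin] by auto
    have "sum (?p x) (g ` F) = 1"
      using g F(3) by (subst sum.reindex) (auto simp: inj_on_def inv_f_f)
    moreover have "{w. ?p x w \<noteq> 0} \<subseteq> g ` F" using F(2) g by auto
    ultimately show ?thesis using F(1) x0 by (intro iffD2[OF r(2)] conjI allI bexI[of _ "g ` F"]) auto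
  qed
  have q: "?q y \<in> geometric_realization (faces \<Phi>) \<and> ?p (?q y) = y"
    if yin: "y \<in> geometric_realization (faces ((`) g ` \<Phi>))" for y
  proof -
    obtain F where F: "F \<in> \<Phi>" "{v. y v \<noteq> 0} \<subseteq> g ` F" "sum y (g ` F) = 1" and y0: "\<forall>v. 0 \<le> y v"
      using iffD1[OF r(2) yin] by auto
    have "sum (?q y) F = 1"
      using g F(3) by (subst (asm) sum.reindex) (auto simp: inj_on_def)
    moreover have "{v. ?q y v \<noteq> 0} \<subseteq> F" using F(2) g by (auto simp: inj_def)
    moreover have "?p (?q y) = y"
      using F(2) by (auto simp: fun_eq_iff f_inv_into_f)
    ultimately show ?thesis using F(1) y0 by (intro conjI iffD2[OF r(1)] allI bexI[of _ F]) auto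
  qed
  have qp: "?q (?p x) = x" for x :: "'a \<Rightarrow> real" using g by (auto simp: inv_f_f)
  show ?thesis
  proof (rule homeomorphic_by_inverses[where f = ?p and g = ?q])
    show "continuous_on (geometric_realization (faces \<Phi>)) ?p"
    proof (rule continuous_on_coordinatewise_then_product)
      fix w
      show "continuous_on (geometric_realization (faces \<Phi>)) (\<lambda>x. ?p x w)"
        by (cases "w \<in> range g")
           (auto intro: continuous_on_subset[OF continuous_on_product_coordinates])
    qed
    show "continuous_on (geometric_realization (faces ((`) g ` \<Phi>))) ?q"
      by (rule continuous_on_coordinatewise_then_product)
         (auto intro: continuous_on_subset[OF continuous_on_product_coordinates])
  qed (use p q qp in simp_all)
qed

section \<open>The boundary of a simplex as a sphere\<close>

lemma Basis_real_vec: "(Basis :: (real ^ 'n) set) = range (\<lambda>i. axis i 1)"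
  unfolding Basis_vec_def by auto

text \<open>The simplex is full-dimensional, so its relative frontier is its frontier: the points
  where a defining inequality is tight.\<close>

lemma frontier_std_simplex_vec:
  "rel_frontier (convex hull (insert 0 Basis) :: (real ^ 'n) set) =
    {x. (\<forall>i. 0 \<le> x $ i) \<and> (\<Sum>i\<in>UNIV. x $ i) \<le> 1 \<and> ((\<exists>i. x $ i = 0) \<or> (\<Sum>i\<in>UNIV. x $ i) = 1)}"
proof -
  let ?S = "convex hull (insert 0 Basis) :: (real ^ 'n) set"
  have sum_Basis: "sum ((\<bullet>) x) Basis = (\<Sum>i\<in>UNIV. x $ i)" for x :: "real ^ 'n"
    unfolding Basis_real_vec
    by (subst sum.reindex) (auto simp: inj_on_def axis_eq_axis inner_axis)
  have all_Basis: "(\<forall>b\<in>Basis. P (x \<bullet> b)) \<longleftrightarrow> (\<forall>i. P (x $ i))" for P and x :: "real ^ 'n"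
    unfolding Basis_real_vec by (simp add: inner_axis)
  have "rel_frontier ?S = frontier ?S"
    using interior_std_simplex_nonempty[where 'a = "real ^ 'n"]
    by (metis empty_iff rel_frontier_nonempty_interior)
  also have "\<dots> = ?S - interior ?S"
    unfolding frontier_def by (simp add: closure_closed compact_imp_closed finite_imp_compact_convex_hull)
  also have "\<dots> = {x. (\<forall>i. 0 \<le> x $ i) \<and> (\<Sum>i\<in>UNIV. x $ i) \<le> 1 \<and>
      ((\<exists>i. x $ i = 0) \<or> (\<Sum>i\<in>UNIV. x $ i) = 1)}"
  proof (intro set_eqI)
    fix x :: "real ^ 'n"
    have "(\<exists>i. \<not> 0 < x $ i) \<longleftrightarrow> (\<exists>i. x $ i = 0)" if "\<forall>i. 0 \<le> x $ i"
      using that by (metis less_eq_real_def less_irrefl)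
    then show "x \<in> ?S - interior ?S \<longleftrightarrow> x \<in> {x. (\<forall>i. 0 \<le> x $ i) \<and> (\<Sum>i\<in>UNIV. x $ i) \<le> 1 \<and>
        ((\<exists>i. x $ i = 0) \<or> (\<Sum>i\<in>UNIV. x $ i) = 1)}"
      unfolding interior_std_simplex unfolding std_simplex
      unfolding sum_Basis all_Basis Diff_iff mem_Collect_eq
      by (metis not_less less_eq_real_def)
  qed
  finally show ?thesis .
qed

text \<open>Bounded convex sets of equal dimension have homeomorphic relative frontiers; this is
  applied to the standard simplex and the ball. The vertex \<open>p\<close> plays the origin: its
  barycentric coordinate is one minus the sum of the others.\<close>

lemma boundary_of_simplex_homeomorphic_sphere:
  fixes e :: "'n::finite \<Rightarrow> 'a" and p :: 'a
  assumes inj: "inj e" and p: "p \<notin> range e"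
  shows "geometric_realization (faces ((\<lambda>v. insert p (range e) - {v}) ` insert p (range e)))
    homeomorphic sphere (0 :: real ^ 'n) 1"
proof -
  define V where "V = insert p (range e)"
  define \<Phi> where "\<Phi> = (\<lambda>v. V - {v}) ` V"
  define D where "D = {x :: real ^ 'n. (\<forall>i. 0 \<le> x $ i) \<and> (\<Sum>i\<in>UNIV. x $ i) \<le> 1 \<and>
      ((\<exists>i. x $ i = 0) \<or> (\<Sum>i\<in>UNIV. x $ i) = 1)}"
  let ?S = "convex hull (insert 0 Basis) :: (real ^ 'n) set"
  have "interior ?S \<noteq> {}"
    using interior_std_simplex_nonempty[where 'a = "real ^ 'n"] by blast
  then have "aff_dim ?S = aff_dim (cball (0 :: real ^ 'n) 1)"
    by (simp add: aff_dim_cball aff_dim_nonempty_interior)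
  then have "rel_frontier ?S homeomorphic rel_frontier (cball (0 :: real ^ 'n) 1)"
    by (intro homeomorphic_rel_frontiers_convex_bounded_sets)
       (auto simp: finite_imp_bounded_convex_hull bounded_convex_hull finite_imp_bounded)
  then have DS: "D homeomorphic sphere (0 :: real ^ 'n) 1"
    unfolding frontier_std_simplex_vec D_def by (simp add: rel_frontier_cball)
  have DG: "D homeomorphic geometric_realization (faces \<Phi>)"
  proof -
    define h where "h = (\<lambda>(x :: real ^ 'n) v. if v = p then 1 - (\<Sum>i\<in>UNIV. x $ i)
      else if v \<in> range e then x $ inv e v else 0)"
    define k where "k = (\<lambda>y. (\<chi> i. y (e i)) :: real ^ 'n)"
    have V: "finite V" unfolding V_def by simp
    have \<Phi>: "\<forall>F\<in>\<Phi>. finite F" unfolding \<Phi>_def using V by simp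
    note r = geometric_realization_faces[OF \<Phi>]
    have he: "h x (e i) = x $ i" for x i
      unfolding h_def using inj p by auto
    have sum_V: "sum y V = y p + (\<Sum>i\<in>UNIV. y (e i))" for y :: "'a \<Rightarrow> real"
      unfolding V_def using p inj by (simp add: sum.reindex)
    have supp: "h x v = 0" if "v \<notin> V" for x v
      using that unfolding h_def V_def by auto
    have h: "h x \<in> geometric_realization (faces \<Phi>)" if x: "x \<in> D" for x
    proof -
      have nonneg: "0 \<le> h x v" for v using x unfolding D_def h_def by auto
      have sum1: "sum (h x) V = 1" unfolding sum_V he by (simp add: h_def)
      obtain v where v: "v \<in> V" "h x v = 0"
      proof -
        consider i where "x $ i = 0" | "(\<Sum>i\<in>UNIV. x $ i) = 1" using x unfolding D_def by auto
        then show ?thesis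
        proof cases
          case 1
          then show ?thesis using that[of "e i"] he unfolding V_def by auto
        next
          case 2
          then show ?thesis using that[of p] unfolding V_def h_def by auto
        qed
      qed
      have "V - {v} \<in> \<Phi>" using v unfolding \<Phi>_def by auto
      moreover have "{w. h x w \<noteq> 0} \<subseteq> V - {v}" using v supp by auto
      moreover have "sum (h x) (V - {v}) = 1" using v V sum1 by (simp add: sum_diff1)
      ultimately show ?thesis
        using nonneg by (intro iffD2[OF r] conjI allI bexI[of _ "V - {v}"])
    qed
    have k: "k y \<in> D \<and> h (k y) = y" if y: "y \<in> geometric_realization (faces \<Phi>)" for y
    proof -
      obtain F where nonneg: "\<forall>v. 0 \<le> y v" and F: "F \<in> \<Phi>" "{v. y v \<noteq> 0} \<subseteq> F" "sum y F = 1"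
        using iffD1[OF r y] by (elim conjE bexE)
      obtain v where v: "v \<in> V" "F = V - {v}" using F(1) unfolding \<Phi>_def by auto
      have yv: "y v = 0" and yV: "\<And>w. w \<notin> V \<Longrightarrow> y w = 0" using F(2) v by auto
      have "sum y V = 1" using F(3) v yv V by (simp add: sum_diff1)
      then have s: "y p + (\<Sum>i\<in>UNIV. y (e i)) = 1" unfolding sum_V .
      have hk: "h (k y) w = y w" for w
        using s yV[of w] inj unfolding h_def k_def V_def by auto
      have "(\<exists>i. y (e i) = 0) \<or> y p = 0" using yv v(1) unfolding V_def by auto
      moreover have "(\<Sum>i\<in>UNIV. y (e i)) \<le> 1" using s nonneg[rule_format, of p] by linarith
      ultimately have "k y \<in> D" unfolding D_def k_def using nonneg s by auto
      then show ?thesis using hk by auto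
    qed
    show ?thesis
    proof (rule homeomorphic_by_inverses)
      show "continuous_on D h"
      proof (rule continuous_on_coordinatewise_then_product)
        fix v
        show "continuous_on D (\<lambda>x. h x v)"
          unfolding h_def by (cases "v = p"; cases "v \<in> range e") (auto intro!: continuous_intros)
      qed
      show "continuous_on (geometric_realization (faces \<Phi>)) k"
        unfolding k_def
        by (intro continuous_on_vec_lambda continuous_on_subset[OF continuous_on_product_coordinates]) simp
      show "k (h x) = x" for x unfolding k_def he by simp
    qed (use h in blast, use k in blast, use k in blast)
  qed
  show ?thesis
    using homeomorphic_trans[OF iffD1[OF homeomorphic_sym DG] DS] unfolding \<Phi>_def V_def .
qed

section \<open>Complexes from region maps on the grid\<close>

datatype vert = VA int | VB int | VO nat

definition tet :: "int \<Rightarrow> int \<Rightarrow> vert set" where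
  "tet i j = {VA i, VA (i + 1), VB j, VB (j + 1)}"

definition htri :: "int \<Rightarrow> int \<Rightarrow> vert set" where
  "htri i j = {VA i, VB j, VB (j + 1)}"

definition vtri :: "int \<Rightarrow> int \<Rightarrow> vert set" where
  "vtri i j = {VA i, VA (i + 1), VB j}"

text \<open>A region map \<open>f\<close> keeps the tetrahedron of every cell sent to \<open>None\<close>, and replaces the cells
  sent to \<open>Some y\<close> by the cone with apex \<open>VO y\<close> over the boundary of their union. Below, region 0
  always contains all cells outside a rectangle; its cone closes the ball to a sphere. The triangle
  \<open>htri i j\<close> separates the cells \<open>(i - 1, j)\<close> and \<open>(i, j)\<close>, and \<open>vtri i j\<close> separates
  \<open>(i, j - 1)\<close> and \<open>(i, j)\<close>.\<close>

definition facets :: "(int \<Rightarrow> int \<Rightarrow> nat option) \<Rightarrow> vert set set" where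
  "facets f = {tet i j |i j. f i j = None}
     \<union> {insert (VO y) (htri i j) |y i j. (f (i - 1) j = Some y) \<noteq> (f i j = Some y)}
     \<union> {insert (VO y) (vtri i j) |y i j. (f i (j - 1) = Some y) \<noteq> (f i j = Some y)}"

lemma facetsE:
  assumes "F \<in> facets f"
  obtains (tet) i j where "F = tet i j" "f i j = None"
    | (htri) y i j where "F = insert (VO y) (htri i j)" "(f (i - 1) j = Some y) \<noteq> (f i j = Some y)"
    | (vtri) y i j where "F = insert (VO y) (vtri i j)" "(f i (j - 1) = Some y) \<noteq> (f i j = Some y)"
  using assms unfolding facets_def by blast

text \<open>Facets of every region map have one of these shapes, so two facet families can be
  compared shape by shape.\<close>

definition cell_shape :: "vert set \<Rightarrow> bool" where
  "cell_shape F \<longleftrightarrow> (\<exists>i j. F = tet i j) \<or> (\<exists>y i j. F = insert (VO y) (htri i j))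
     \<or> (\<exists>y i j. F = insert (VO y) (vtri i j))"

lemma facets_cell_shape: "F \<in> facets f \<Longrightarrow> cell_shape F"
  unfolding facets_def cell_shape_def by blast

lemma mem_cell [simp]:
  "VA k \<in> tet i j \<longleftrightarrow> k = i \<or> k = i + 1" "VB k \<in> tet i j \<longleftrightarrow> k = j \<or> k = j + 1" "VO y \<notin> tet i j"
  "VA k \<in> htri i j \<longleftrightarrow> k = i" "VB k \<in> htri i j \<longleftrightarrow> k = j \<or> k = j + 1" "VO y \<notin> htri i j"
  "VA k \<in> vtri i j \<longleftrightarrow> k = i \<or> k = i + 1" "VB k \<in> vtri i j \<longleftrightarrow> k = j" "VO y \<notin> vtri i j"
  unfolding tet_def htri_def vtri_def by auto

lemma consecutive_pair_eq: "(\<forall>k::int. (k = i \<or> k = i + 1) \<longleftrightarrow> (k = i' \<or> k = i' + 1)) \<longleftrightarrow> i = i'"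
  by presburger

lemma consecutive_pair_ne_singleton: "\<exists>k::int. (k = i \<or> k = i + 1) \<noteq> (k = i')"
  by presburger

lemma all_vert: "(\<forall>v. P v) \<longleftrightarrow> (\<forall>k. P (VA k)) \<and> (\<forall>k. P (VB k)) \<and> (\<forall>y. P (VO y))"
  by (metis vert.exhaust)

text \<open>Vertex by vertex: two consecutive indices determine the smaller one and never collapse
  to one index, which separates cones over the two kinds of triangle. An apex separates cones from
  plain tetrahedra.\<close>

lemma facet_eq [simp]:
  "tet i j = tet i' j' \<longleftrightarrow> i = i' \<and> j = j'"
  "insert (VO y) (htri i j) = insert (VO y') (htri i' j') \<longleftrightarrow> y = y' \<and> i = i' \<and> j = j'"
  "insert (VO y) (vtri i j) = insert (VO y') (vtri i' j') \<longleftrightarrow> y = y' \<and> i = i' \<and> j = j'"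
  "insert (VO y) (htri i j) \<noteq> insert (VO y') (vtri i' j')"
  "insert (VO y) (vtri i' j') \<noteq> insert (VO y') (htri i j)"
  "tet i j \<noteq> insert (VO y) F" "insert (VO y) F \<noteq> tet i j"
proof -
  show "tet i j = tet i' j' \<longleftrightarrow> i = i' \<and> j = j'"
    by (simp add: set_eq_iff all_vert consecutive_pair_eq)
  show "insert (VO y) (htri i j) = insert (VO y') (htri i' j') \<longleftrightarrow> y = y' \<and> i = i' \<and> j = j'"
    by (auto simp: set_eq_iff all_vert consecutive_pair_eq)
  show "insert (VO y) (vtri i j) = insert (VO y') (vtri i' j') \<longleftrightarrow> y = y' \<and> i = i' \<and> j = j'"
    by (auto simp: set_eq_iff all_vert consecutive_pair_eq)
  show n: "insert (VO y) (htri i j) \<noteq> insert (VO y') (vtri i' j')" for y y' i j i' j'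
    using consecutive_pair_ne_singleton[of j j'] by (auto simp: set_eq_iff all_vert)
  show "insert (VO y) (vtri i' j') \<noteq> insert (VO y') (htri i j)" using n by metis
  show n: "tet i j \<noteq> insert (VO y) F" by (metis insertI1 mem_cell(3))
  then show "insert (VO y) F \<noteq> tet i j" by metis
qed

lemma mem_facets [simp]:
  "tet i j \<in> facets f \<longleftrightarrow> f i j = None"
  "insert (VO y) (htri i j) \<in> facets f \<longleftrightarrow> (f (i - 1) j = Some y) \<noteq> (f i j = Some y)"
  "insert (VO y) (vtri i j) \<in> facets f \<longleftrightarrow> (f i (j - 1) = Some y) \<noteq> (f i j = Some y)"
  unfolding facets_def by auto

text \<open>The triangle opposite \<open>VA i\<close> is shared with the cell
  \<open>(i + 1, j)\<close>, the one opposite \<open>VA (i + 1)\<close> with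
  \<open>(i - 1, j)\<close>, and likewise for \<open>VB\<close>.\<close>

lemma tet_minus [simp]:
  "tet i j - {VA i} = htri (i + 1) j" "tet i j - {VA (i + 1)} = htri i j"
  "tet i j - {VB j} = vtri i (j + 1)" "tet i j - {VB (j + 1)} = vtri i j"
  unfolding tet_def htri_def vtri_def by auto

section \<open>Absorbing one cell into a region\<close>

definition absorb :: "(int \<Rightarrow> int \<Rightarrow> nat option) \<Rightarrow> int \<Rightarrow> int \<Rightarrow> nat \<Rightarrow> int \<Rightarrow> int \<Rightarrow> nat option" where
  "absorb f i j y = f(i := (f i)(j := Some y))"

lemma absorb_apply: "absorb f i j y i' j' = (if i' = i \<and> j' = j then Some y else f i' j')"
  unfolding absorb_def by simp

text \<open>\<open>P\<close> collects the vertices of the cell whose opposite triangle borders region \<open>y\<close>.\<close>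

lemma bistellar_absorb:
  assumes free: "f i j = None"
    and P: "P \<subseteq> tet i j" "P \<noteq> tet i j"
      "VA i \<in> P \<longleftrightarrow> f (i + 1) j = Some y" "VA (i + 1) \<in> P \<longleftrightarrow> f (i - 1) j = Some y"
      "VB j \<in> P \<longleftrightarrow> f i (j + 1) = Some y" "VB (j + 1) \<in> P \<longleftrightarrow> f i (j - 1) = Some y"
    and star: "\<And>F. F \<in> facets f \<Longrightarrow> tet i j - P \<subseteq> F \<Longrightarrow>
      F = tet i j \<or> (\<exists>p\<in>P. F = insert (VO y) (tet i j - {p}))"
    and new: "\<And>F. F \<in> facets f \<Longrightarrow> \<not> insert (VO y) P \<subseteq> F"
  shows "bistellar (tet i j - P) (insert (VO y) P) (facets f) (facets (absorb f i j y))"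
proof -
  let ?T = "tet i j"
  have tet_cases: "v = VA i \<or> v = VA (i + 1) \<or> v = VB j \<or> v = VB (j + 1)" if "v \<in> ?T" for v
    using that unfolding tet_def by auto
  have fin: "finite ?T" "finite P"
    using P(1) by (auto simp: tet_def intro: finite_subset)
  have yP: "VO y \<notin> P" using P(1) by auto
  have old: "insert (VO y) (?T - {p}) \<in> facets f" if "p \<in> P" for p
  proof -
    have "p \<in> ?T" using that P(1) by auto
    from tet_cases[OF this] show ?thesis
      using that P(3-6) free by (elim disjE) simp_all
  qed
  \<comment> \<open>The move has \<open>A = ?T - P\<close> and \<open>B = insert (VO y) P\<close>.
    Omitting \<open>VO y\<close> from \<open>B\<close> yields the cell itself, omitting
    \<open>p\<close> the cone over the triangle opposite \<open>p\<close>.\<close>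
  have "{F \<in> facets f. ?T - P \<subseteq> F} = insert ?T ((\<lambda>p. insert (VO y) (?T - {p})) ` P)"
    using star old free by auto
  also have "\<dots> = (\<lambda>b. ?T - P \<union> (insert (VO y) P - {b})) ` insert (VO y) P"
  proof -
    have "?T - P \<union> (insert (VO y) P - {VO y}) = ?T" using P(1) yP by auto
    moreover have "?T - P \<union> (insert (VO y) P - {p}) = insert (VO y) (?T - {p})" if "p \<in> P" for p
      using P(1) yP that by auto
    ultimately show ?thesis by auto
  qed
  finally have 1: "{F \<in> facets f. ?T - P \<subseteq> F} =
    (\<lambda>b. ?T - P \<union> (insert (VO y) P - {b})) ` insert (VO y) P" .
  have "(\<lambda>a. insert (VO y) P \<union> (?T - P - {a})) ` (?T - P) = (\<lambda>a. insert (VO y) (?T - {a})) ` (?T - P)"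
    using P(1) by (intro image_cong) auto
  \<comment> \<open>The cell carried no label, so only the boundary of region \<open>y\<close>
    changes: triangles opposite \<open>P\<close> become interior and the other triangles of the cell
    become boundary.\<close>
  moreover have "facets (absorb f i j y) =
    {F \<in> facets f. \<not> ?T - P \<subseteq> F} \<union> (\<lambda>a. insert (VO y) (?T - {a})) ` (?T - P)"
    (is "_ = ?R")
  proof -
    have R: "F \<in> ?R \<longleftrightarrow> F \<in> facets f \<and> F \<noteq> ?T \<and> F \<notin> (\<lambda>p. insert (VO y) (?T - {p})) ` P
        \<or> F \<in> (\<lambda>a. insert (VO y) (?T - {a})) ` (?T - P)" for F
      using star by auto
    have img: "F \<in> (\<lambda>p. insert (VO y) (?T - {p})) ` Q \<longleftrightarrow>
        VA i \<in> Q \<and> F = insert (VO y) (htri (i + 1) j) \<or> VA (i + 1) \<in> Q \<and> F = insert (VO y) (htri i j) \<or>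
        VB j \<in> Q \<and> F = insert (VO y) (vtri i (j + 1)) \<or> VB (j + 1) \<in> Q \<and> F = insert (VO y) (vtri i j)"
      if "Q \<subseteq> ?T" for F Q
    proof
      assume "F \<in> (\<lambda>p. insert (VO y) (?T - {p})) ` Q"
      then obtain p where "p \<in> Q" "F = insert (VO y) (?T - {p})" by blast
      then show "VA i \<in> Q \<and> F = insert (VO y) (htri (i + 1) j) \<or> VA (i + 1) \<in> Q \<and> F = insert (VO y) (htri i j) \<or>
        VB j \<in> Q \<and> F = insert (VO y) (vtri i (j + 1)) \<or> VB (j + 1) \<in> Q \<and> F = insert (VO y) (vtri i j)"
        using tet_cases[of p] that by (metis subsetD tet_minus)
    next
      assume "VA i \<in> Q \<and> F = insert (VO y) (htri (i + 1) j) \<or> VA (i + 1) \<in> Q \<and> F = insert (VO y) (htri i j) \<or>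
        VB j \<in> Q \<and> F = insert (VO y) (vtri i (j + 1)) \<or> VB (j + 1) \<in> Q \<and> F = insert (VO y) (vtri i j)"
      then show "F \<in> (\<lambda>p. insert (VO y) (?T - {p})) ` Q"
        unfolding tet_minus[of i j, symmetric] by blast
    qed
    note imgs = img[OF P(1)] img[OF Diff_subset]
    have shape: "F \<in> facets (absorb f i j y) \<longleftrightarrow> F \<in> ?R"
      if "cell_shape F" for F
      using that unfolding cell_shape_def
    proof (elim disjE exE)
      fix i' j' assume F: "F = tet i' j'"
      show ?thesis unfolding R imgs F by (auto simp: absorb_apply free)
    next
      fix z i' j' assume F: "F = insert (VO z) (htri i' j')"
      show ?thesis unfolding R imgs F using P(3-6) free by (auto simp: absorb_apply)
    next
      fix z i' j' assume F: "F = insert (VO z) (vtri i' j')"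
      show ?thesis unfolding R imgs F using P(3-6) free by (auto simp: absorb_apply)
    qed
    show ?thesis
    proof (intro set_eqI iffI)
      fix F assume F: "F \<in> facets (absorb f i j y)"
      then show "F \<in> ?R" using shape[OF facets_cell_shape[OF F]] by blast
    next
      fix F assume F: "F \<in> ?R"
      have "cell_shape F"
      proof (cases "F \<in> facets f")
        case False
        with F have "F \<in> (\<lambda>a. insert (VO y) (?T - {a})) ` (?T - P)" by blast
        then show ?thesis unfolding imgs(2) cell_shape_def by blast
      qed (rule facets_cell_shape)
      then show "F \<in> facets (absorb f i j y)" using shape F by blast
    qed
  qed
  ultimately have 2: "facets (absorb f i j y) =
    {F \<in> facets f. \<not> ?T - P \<subseteq> F} \<union> (\<lambda>a. insert (VO y) P \<union> (?T - P - {a})) ` (?T - P)" by simp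
  have "\<forall>F\<in>facets f. finite F"
    by (auto elim!: facetsE simp: tet_def htri_def vtri_def)
  then show ?thesis
    unfolding bistellar_def using 1 2 fin P(1,2) yP new by auto
qed

section \<open>Moves of types 1-4, 2-3, 3-2 and 4-1 on region maps\<close>

definition spherical :: "(int \<Rightarrow> int \<Rightarrow> nat option) \<Rightarrow> bool" where
  "spherical f \<longleftrightarrow> geometric_realization (faces (facets f)) homeomorphic sphere (0 :: real ^ 4) 1"

text \<open>An equivalence, because the grid is built by undoing moves, while strips and flips arise
  by performing them.\<close>

lemma spherical_bistellar:
  assumes "bistellar A B (facets f) (facets g)"
  shows "spherical g \<longleftrightarrow> spherical f"
proof -
  note fg = bistellar_homeomorphic[OF assms]
    and gf = bistellar_homeomorphic[OF bistellar_sym[OF assms]]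
  show ?thesis
    unfolding spherical_def using homeomorphic_trans[OF fg] homeomorphic_trans[OF gf] by blast
qed

text \<open>A 1-4 move: with \<open>P = {}\<close> the tetrahedron is subdivided at the new vertex
  \<open>VO y\<close>.\<close>

lemma absorb_fresh:
  assumes "f i j = None" "\<And>k l. f k l \<noteq> Some y"
  shows "spherical (absorb f i j y) \<longleftrightarrow> spherical f"
proof (rule spherical_bistellar[OF bistellar_absorb])
  show "{} \<noteq> tet i j" unfolding tet_def by simp
  fix F assume F: "F \<in> facets f"
  show "F = tet i j \<or> (\<exists>p\<in>{}. F = insert (VO y) (tet i j - {p}))" if "tet i j - {} \<subseteq> F"
  proof -
    have "VA i \<in> F" "VA (i + 1) \<in> F" "VB j \<in> F" "VB (j + 1) \<in> F" using that by auto
    then show ?thesis using F assms by (elim facetsE) auto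
  qed
  show "\<not> insert (VO y) {} \<subseteq> F" using F assms by (elim facetsE) auto
qed (use assms in simp_all)

text \<open>A 2-3 move across the triangle shared with the cell above. The region lies above row
  \<open>j\<close>, so the edge from \<open>VO y\<close> to \<open>VB j\<close> is new.\<close>

lemma absorb_below:
  assumes "f i j = None" "f i (j + 1) = Some y"
    "f (i - 1) j \<noteq> Some y" "f (i + 1) j \<noteq> Some y"
    "\<And>k l. f k l = Some y \<Longrightarrow> j < l"
  shows "spherical (absorb f i j y) \<longleftrightarrow> spherical f"
proof (rule spherical_bistellar[OF bistellar_absorb])
  have "VA i \<in> tet i j" "VA i \<notin> {VB j}" by simp_all
  then show "{VB j} \<noteq> tet i j" by metis
  show "VB (j + 1) \<in> {VB j} \<longleftrightarrow> f i (j - 1) = Some y" using assms(5)[of i "j - 1"] by auto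
  fix F assume F: "F \<in> facets f"
  show "F = tet i j \<or> (\<exists>p\<in>{VB j}. F = insert (VO y) (tet i j - {p}))" if "tet i j - {VB j} \<subseteq> F"
  proof -
    have "VA i \<in> F" "VA (i + 1) \<in> F" "VB (j + 1) \<in> F" using that by auto
    then show ?thesis using F assms by (elim facetsE) auto
  qed
  show "\<not> insert (VO y) {VB j} \<subseteq> F"
    using F assms(5) by (elim facetsE) force+
qed (use assms in simp_all)

text \<open>A 2-3 move across the triangle shared with the left neighbour. The region lies left of
  column \<open>i\<close>, so the edge from \<open>VO y\<close> to \<open>VA (i + 1)\<close> is
  new.\<close>

lemma absorb_right:
  assumes "f i j = None" "f (i - 1) j = Some y"
    "f i (j - 1) \<noteq> Some y" "f i (j + 1) \<noteq> Some y"
    "\<And>k l. f k l = Some y \<Longrightarrow> k < i"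
  shows "spherical (absorb f i j y) \<longleftrightarrow> spherical f"
proof (rule spherical_bistellar[OF bistellar_absorb])
  have "VB j \<in> tet i j" "VB j \<notin> {VA (i + 1)}" by simp_all
  then show "{VA (i + 1)} \<noteq> tet i j" by metis
  show "VA i \<in> {VA (i + 1)} \<longleftrightarrow> f (i + 1) j = Some y" using assms(5)[of "i + 1" j] by auto
  fix F assume F: "F \<in> facets f"
  show "F = tet i j \<or> (\<exists>p\<in>{VA (i + 1)}. F = insert (VO y) (tet i j - {p}))"
    if "tet i j - {VA (i + 1)} \<subseteq> F"
  proof -
    have "VA i \<in> F" "VB j \<in> F" "VB (j + 1) \<in> F" using that by auto
    then show ?thesis using F assms by (elim facetsE) auto
  qed
  show "\<not> insert (VO y) {VA (i + 1)} \<subseteq> F"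
    using F assms(5) by (elim facetsE) force+
qed (use assms in simp_all)

text \<open>A 3-2 flip of the edge from \<open>VA (i + 1)\<close> to \<open>VB (j + 1)\<close>: the
  other three cells around it lie in region \<open>y\<close>, so exactly three facets contain it. No
  cell around the edge from \<open>VA i\<close> to \<open>VB j\<close> is in the region, hence the
  triangle spanned by that edge and \<open>VO y\<close> is missing.\<close>

lemma absorb_corner:
  assumes "f i j = None" "f (i + 1) j = Some y" "f i (j + 1) = Some y" "f (i + 1) (j + 1) = Some y"
    "f (i - 1) j \<noteq> Some y" "f i (j - 1) \<noteq> Some y" "f (i - 1) (j - 1) \<noteq> Some y"
  shows "spherical (absorb f i j y) \<longleftrightarrow> spherical f"
proof (rule spherical_bistellar[OF bistellar_absorb])
  have "VA (i + 1) \<in> tet i j" "VA (i + 1) \<notin> {VA i, VB j}" by simp_all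
  then show "{VA i, VB j} \<noteq> tet i j" by metis
  fix F assume F: "F \<in> facets f"
  show "F = tet i j \<or> (\<exists>p\<in>{VA i, VB j}. F = insert (VO y) (tet i j - {p}))"
    if "tet i j - {VA i, VB j} \<subseteq> F"
  proof -
    have "VA (i + 1) \<in> F" "VB (j + 1) \<in> F" using that by auto
    then show ?thesis using F assms by (elim facetsE) auto
  qed
  show "\<not> insert (VO y) {VA i, VB j} \<subseteq> F"
    using F assms by (elim facetsE) auto
qed (use assms in simp_all)

text \<open>A 4-1 move deleting \<open>VA (i + 1)\<close>: all other cells of columns
  \<open>i\<close> and \<open>i + 1\<close> lie in region \<open>y\<close>, so only the tetrahedron
  and three cones contain this vertex.\<close>

lemma absorb_last_column:
  assumes "f i j = None" "\<And>l. l \<noteq> j \<Longrightarrow> f i l = Some y" "\<And>l. f (i + 1) l = Some y"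
    "f (i - 1) j \<noteq> Some y"
  shows "spherical (absorb f i j y) \<longleftrightarrow> spherical f"
proof (rule spherical_bistellar[OF bistellar_absorb])
  let ?P = "{VA i, VB j, VB (j + 1)}"
  have "VA (i + 1) \<in> tet i j" "VA (i + 1) \<notin> ?P" by simp_all
  then show "?P \<noteq> tet i j" by metis
  fix F assume F: "F \<in> facets f"
  show "F = tet i j \<or> (\<exists>p\<in>?P. F = insert (VO y) (tet i j - {p}))" if "tet i j - ?P \<subseteq> F"
  proof -
    have "VA (i + 1) \<in> F" using that by auto
    then show ?thesis using F
    proof (elim facetsE)
      fix k l assume "VA (i + 1) \<in> F" "F = tet k l" "f k l = None"
      then show ?thesis using assms(2,3) by (cases "l = j") auto
    next
      fix z k l assume "VA (i + 1) \<in> F" "F = insert (VO z) (htri k l)"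
        "(f (k - 1) l = Some z) \<noteq> (f k l = Some z)"
      then show ?thesis using assms by (cases "l = j") auto
    next
      fix z k l assume "VA (i + 1) \<in> F" "F = insert (VO z) (vtri k l)"
        "(f k (l - 1) = Some z) \<noteq> (f k l = Some z)"
      then show ?thesis using assms by (cases "l = j"; cases "l = j + 1") auto
    qed
  qed
  show "\<not> insert (VO y) ?P \<subseteq> F"
    using F assms by (elim facetsE) auto
qed (use assms in simp_all)

text \<open>The 4-1 move with the two paths exchanged; it deletes \<open>VB (j + 1)\<close>.\<close>

lemma absorb_last_row:
  assumes "f i j = None" "\<And>k. k \<noteq> i \<Longrightarrow> f k j = Some y" "\<And>k. f k (j + 1) = Some y"
    "f i (j - 1) \<noteq> Some y"
  shows "spherical (absorb f i j y) \<longleftrightarrow> spherical f"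
proof (rule spherical_bistellar[OF bistellar_absorb])
  let ?P = "{VB j, VA i, VA (i + 1)}"
  have "VB (j + 1) \<in> tet i j" "VB (j + 1) \<notin> ?P" by simp_all
  then show "?P \<noteq> tet i j" by metis
  fix F assume F: "F \<in> facets f"
  show "F = tet i j \<or> (\<exists>p\<in>?P. F = insert (VO y) (tet i j - {p}))" if "tet i j - ?P \<subseteq> F"
  proof -
    have "VB (j + 1) \<in> F" using that by auto
    then show ?thesis using F
    proof (elim facetsE)
      fix k l assume "VB (j + 1) \<in> F" "F = tet k l" "f k l = None"
      then show ?thesis using assms(2,3) by (cases "k = i") auto
    next
      fix z k l assume "VB (j + 1) \<in> F" "F = insert (VO z) (vtri k l)"
        "(f k (l - 1) = Some z) \<noteq> (f k l = Some z)"
      then show ?thesis using assms by (cases "k = i") auto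
    next
      fix z k l assume "VB (j + 1) \<in> F" "F = insert (VO z) (htri k l)"
        "(f (k - 1) l = Some z) \<noteq> (f k l = Some z)"
      then show ?thesis using assms by (cases "k = i"; cases "k = i + 1") auto
    qed
  qed
  show "\<not> insert (VO y) ?P \<subseteq> F"
    using F assms by (elim facetsE) auto
qed (use assms in simp_all)

section \<open>Grid, strips and independent flips\<close>

definition grid :: "int \<Rightarrow> int \<Rightarrow> int \<Rightarrow> int \<Rightarrow> int \<Rightarrow> nat option" where
  "grid m n r i j = (if 0 \<le> i \<and> i < m \<and> 0 \<le> j \<and> j < n \<or> i = m \<and> 0 \<le> j \<and> j < r then None else Some 0)"

text \<open>A single cell coned from outside is the boundary of the 4-simplex on
  \<open>insert (VO 0) (tet 0 0)\<close>.\<close>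

lemma spherical_single_cell: "spherical (grid 0 n 1)"
proof -
  let ?V = "insert (VO 0) (tet 0 0)"
  have "card (tet 0 0) = CARD(4)" unfolding tet_def by simp
  then obtain e :: "4 \<Rightarrow> vert" where e: "bij_betw e UNIV (tet 0 0)"
    by (metis finite_same_card_bij finite tet_def finite.emptyI finite_insert)
  then have "inj e" "range e = tet 0 0" by (auto simp: bij_betw_def)
  then have "geometric_realization (faces ((\<lambda>v. ?V - {v}) ` ?V)) homeomorphic sphere (0 :: real ^ 4) 1"
    using boundary_of_simplex_homeomorphic_sphere[of e "VO 0"] by simp
  moreover have "(\<lambda>v. ?V - {v}) ` ?V = facets (grid 0 n 1)"
  proof -
    have "(\<lambda>v. ?V - {v}) ` ?V = {tet 0 0, insert (VO 0) (htri 1 0), insert (VO 0) (htri 0 0),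
        insert (VO 0) (vtri 0 1), insert (VO 0) (vtri 0 0)}"
      unfolding tet_def htri_def vtri_def by (auto simp: insert_Diff_if)
    also have "\<dots> = facets (grid 0 n 1)"
    proof -
      have None: "grid 0 n 1 i j = None \<longleftrightarrow> i = 0 \<and> j = 0"
        and Some: "grid 0 n 1 i j = Some y \<longleftrightarrow> (i \<noteq> 0 \<or> j \<noteq> 0) \<and> y = 0" for i j y
        by (auto simp: grid_def)
      show ?thesis
      proof (intro subset_antisym subsetI)
        fix F assume "F \<in> facets (grid 0 n 1)"
        then show "F \<in> {tet 0 0, insert (VO 0) (htri 1 0), insert (VO 0) (htri 0 0),
          insert (VO 0) (vtri 0 1), insert (VO 0) (vtri 0 0)}"
          unfolding facets_def None Some by auto
      qed (auto simp: None Some)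
    qed
    finally show ?thesis .
  qed
  ultimately show ?thesis unfolding spherical_def by simp
qed

text \<open>A 4-1 move read backwards: each cell put on top of the column brings in one new
  vertex.\<close>

lemma spherical_first_column: "spherical (grid 0 n (int r + 1))"
proof (induction r)
  case 0
  show ?case using spherical_single_cell by simp
next
  case (Suc r)
  let ?f = "grid 0 n (int (Suc r) + 1)"
  have "absorb ?f 0 (int r + 1) 0 = grid 0 n (int r + 1)"
    by (auto simp: fun_eq_iff absorb_apply grid_def)
  moreover have "spherical (absorb ?f 0 (int r + 1) 0) \<longleftrightarrow> spherical ?f"
    by (rule absorb_last_row) (auto simp: grid_def)
  ultimately show ?case using Suc by simp
qed

text \<open>The top cell of the partial column \<open>m\<close> is returned to the outside region.
  If it is the bottom cell, this is a 4-1 move deleting \<open>VA (m + 1)\<close>; otherwise the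
  cells below and to the left are filled and a 3-2 flip applies.\<close>

lemma spherical_next_cell:
  assumes "1 \<le> m" "0 \<le> r" "r < n"
  shows "spherical (grid m n r) \<longleftrightarrow> spherical (grid m n (r + 1))"
proof -
  have "absorb (grid m n (r + 1)) m r 0 = grid m n r"
    by (auto simp: fun_eq_iff absorb_apply grid_def)
  moreover have "spherical (absorb (grid m n (r + 1)) m r 0) \<longleftrightarrow> spherical (grid m n (r + 1))"
  proof (cases "r = 0")
    case True
    then show ?thesis using assms by (intro absorb_last_column) (auto simp: grid_def)
  next
    case False
    then show ?thesis using assms by (intro absorb_corner) (auto simp: grid_def)
  qed
  ultimately show ?thesis by simp
qed

lemma spherical_grid:
  assumes "1 \<le> n"
  shows "spherical (grid (int m + 1) n 0)"
proof (induction m)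
  case 0
  have "grid 1 n 0 = grid 0 n n" by (auto simp: fun_eq_iff grid_def)
  then show ?case using spherical_first_column[of n "nat (n - 1)"] assms by simp
next
  case (Suc m)
  have "spherical (grid (int m + 1) n (int r))" if "int r \<le> n" for r
    using that
  proof (induction r)
    case (Suc r)
    then show ?case using spherical_next_cell[of "int m + 1" "int r" n] by (simp add: add.commute)
  qed (use \<open>spherical (grid (int m + 1) n 0)\<close> in simp)
  from this[of "nat n"] have "spherical (grid (int m + 1) n n)" using assms by simp
  \<comment> \<open>A partial column of height \<open>n\<close> is one more full column, which links
    the induction on \<open>r\<close> to the one on \<open>m\<close>.\<close>
  moreover have "grid (int m + 1) n n = grid (int (Suc m) + 1) n 0"
    by (auto simp: fun_eq_iff grid_def)
  ultimately show ?case by simp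
qed

text \<open>The two diagonals of a strip are absorbed in the zigzag order
  \<open>(0, L), (0, L - 1), (1, L - 1), (1, L - 2), \<dots>, (L, 0)\<close>, in which every cell meets its
  predecessors in a single triangle and brings in one new vertex; \<open>r\<close> counts the cells absorbed.\<close>

definition strip :: "(int \<Rightarrow> int \<Rightarrow> nat option) \<Rightarrow> nat \<Rightarrow> int \<Rightarrow> int \<Rightarrow> int \<Rightarrow> int \<Rightarrow> nat option" where
  "strip f y L r i j = (if 0 \<le> i \<and> 0 \<le> j \<and> (i + j = L \<and> 2 * i < r \<or> i + j = L - 1 \<and> 2 * i + 1 < r)
     then Some y else f i j)"

lemma spherical_strip:
  assumes fresh: "\<And>i j. f i j \<noteq> Some y"
    and free: "\<And>i j. 0 \<le> i \<Longrightarrow> 0 \<le> j \<Longrightarrow> i + j = L \<or> i + j = L - 1 \<Longrightarrow> f i j = None"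
    and "int r \<le> 2 * L + 1"
  shows "spherical (strip f y L (int r)) \<longleftrightarrow> spherical f"
  using assms(3)
proof (induction r)
  case 0
  have "strip f y L 0 = f" by (auto simp: fun_eq_iff strip_def)
  then show ?case by simp
next
  case (Suc r)
  let ?f = "strip f y L (int r)"
  show ?case
  \<comment> \<open>Even steps absorb a cell on diagonal \<open>L\<close>, reached (after the first)
    from its left neighbour; odd steps absorb a cell on diagonal \<open>L - 1\<close>, reached from
    the cell above it.\<close>
  proof (cases "even r")
    case True
    then obtain s where r: "int r = 2 * s" by (metis evenE of_nat_mult of_nat_numeral)
    have s: "0 \<le> s" "s \<le> L" using r Suc.prems by auto
    have "strip f y L (int (Suc r)) = absorb ?f s (L - s) y"
      using s r by (auto simp: fun_eq_iff absorb_apply strip_def)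
    moreover have "spherical (absorb ?f s (L - s) y) \<longleftrightarrow> spherical ?f"
    proof (cases "s = 0")
      case True
      show ?thesis
        by (rule absorb_fresh) (use s r True fresh in \<open>auto simp: strip_def free\<close>)
    next
      case False
      show ?thesis
        by (rule absorb_right) (use s r False fresh in \<open>auto simp: strip_def free split: if_splits\<close>)
    qed
    ultimately show ?thesis using Suc by simp
  next
    case False
    then obtain s where r: "int r = 2 * s + 1"
      by (metis oddE of_nat_add of_nat_mult of_nat_numeral of_nat_1)
    have s: "0 \<le> s" "s \<le> L - 1" using r Suc.prems by auto
    have "strip f y L (int (Suc r)) = absorb ?f s (L - 1 - s) y"
      using s r by (auto simp: fun_eq_iff absorb_apply strip_def)
    moreover have "spherical (absorb ?f s (L - 1 - s) y) \<longleftrightarrow> spherical ?f"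
      by (rule absorb_below) (use s r fresh in \<open>auto simp: strip_def free split: if_splits\<close>)
    ultimately show ?thesis using Suc by simp
  qed
qed

text \<open>Strip \<open>k\<close> holds the cells whose \<open>i + j\<close> has quotient
  \<open>k\<close> and nonzero remainder modulo 3. Its label is \<open>k + 1\<close>, as 0 is the
  outside region.\<close>

definition strips :: "nat \<Rightarrow> int \<Rightarrow> int \<Rightarrow> int \<Rightarrow> int \<Rightarrow> nat option" where
  "strips K m n i j = (if 0 \<le> i \<and> 0 \<le> j \<and> (i + j) div 3 < int K \<and> (i + j) mod 3 \<noteq> 0
     then Some (nat ((i + j) div 3) + 1) else grid m n 0 i j)"

lemma spherical_strips:
  assumes "3 * int K \<le> m" "3 * int K \<le> n" "1 \<le> m" "1 \<le> n"
  shows "spherical (strips K m n)"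
  using assms
proof (induction K)
  case 0
  have "strips 0 m n = grid (int (nat (m - 1)) + 1) n 0" using 0 by (auto simp: fun_eq_iff strips_def)
  then show ?case using spherical_grid[OF \<open>1 \<le> n\<close>] by metis
next
  case (Suc K)
  \<comment> \<open>The upper diagonal of the new strip. The count \<open>2 * ?L + 1\<close>
    comprises \<open>?L + 1\<close> cells on it and \<open>?L\<close> on the diagonal below.\<close>
  let ?L = "3 * int K + 2"
  have diag: "(i + j = ?L \<or> i + j = ?L - 1) \<longleftrightarrow> (i + j) div 3 = int K \<and> (i + j) mod 3 \<noteq> 0" for i j
    by presburger
  have "strips (Suc K) m n = strip (strips K m n) (Suc K) ?L (int (nat (2 * ?L + 1)))"
  proof (intro ext)
    fix i j :: int
    show "strips (Suc K) m n i j = strip (strips K m n) (Suc K) ?L (int (nat (2 * ?L + 1))) i j"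
      using diag[of i j] unfolding strips_def strip_def by auto
  qed
  moreover have "spherical (strip (strips K m n) (Suc K) ?L (int (nat (2 * ?L + 1)))) \<longleftrightarrow> spherical (strips K m n)"
  proof (rule spherical_strip)
    show "strips K m n i j \<noteq> Some (Suc K)" for i j
      unfolding strips_def grid_def by (auto split: if_splits)
    show "strips K m n i j = None" if "0 \<le> i" "0 \<le> j" "i + j = ?L \<or> i + j = ?L - 1" for i j
    proof -
      have "(i + j) div 3 = int K" using that(3) unfolding diag by simp
      moreover have "i < m" "j < n" using that Suc.prems by auto
      ultimately show ?thesis using that(1,2) unfolding strips_def grid_def by simp
    qed
  qed simp
  ultimately show ?case using Suc by simp
qed

text \<open>The pair \<open>(p, q)\<close> selects the cell \<open>(3 * p, 3 * q)\<close> on the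
  diagonal just below strip \<open>p + q\<close>, which absorbs it. The surrounding cells each have
  a coordinate not divisible by 3, so the selections do not interfere.\<close>

definition config :: "nat \<Rightarrow> int \<Rightarrow> int \<Rightarrow> (int \<times> int) set \<Rightarrow> int \<Rightarrow> int \<Rightarrow> nat option" where
  "config K m n S i j = (if 3 dvd i \<and> 3 dvd j \<and> (i div 3, j div 3) \<in> S
     then Some (nat ((i + j) div 3) + 1) else strips K m n i j)"

lemma spherical_config:
  assumes "finite S" "\<And>p q. (p, q) \<in> S \<Longrightarrow> 0 \<le> p \<and> 0 \<le> q \<and> p + q < int K"
    and mn: "3 * int K \<le> m" "3 * int K \<le> n" "1 \<le> m" "1 \<le> n"
  shows "spherical (config K m n S)"
  using assms(1,2)
proof (induction S)
  case empty
  have "config K m n {} = strips K m n" by (auto simp: fun_eq_iff config_def)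
  then show ?case using spherical_strips[OF mn] by simp
next
  case (insert x S)
  obtain p q where x: "x = (p, q)" by fastforce
  with insert.prems have pq: "0 \<le> p" "0 \<le> q" "p + q < int K" by auto
  let ?f = "config K m n S" and ?y = "nat (p + q) + 1"
  have "config K m n (insert x S) = absorb ?f (3 * p) (3 * q) ?y"
  proof (intro ext)
    fix i j :: int
    have "3 dvd i \<and> 3 dvd j \<and> (i div 3, j div 3) = x \<longleftrightarrow> i = 3 * p \<and> j = 3 * q" unfolding x by auto
    moreover have "(3 * p + 3 * q) div 3 = p + q" by presburger
    ultimately show "config K m n (insert x S) i j = absorb ?f (3 * p) (3 * q) ?y i j"
      unfolding absorb_apply config_def by auto
  qed
  moreover have "spherical (absorb ?f (3 * p) (3 * q) ?y) \<longleftrightarrow> spherical ?f"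
  \<comment> \<open>The cells to the right, above and diagonally above lie in strip
    \<open>p + q\<close>; those on the opposite sides can only lie in the preceding strip or outside
    the grid.\<close>
  proof (rule absorb_corner)
    have nd: "\<not> 3 dvd 3 * z + 1" "\<not> 3 dvd 3 * z - 1" for z :: int by presburger+
    have "(3 * p + 3 * q) mod 3 = 0" by presburger
    then show "?f (3 * p) (3 * q) = None"
      using insert.hyps(2) pq mn unfolding config_def strips_def grid_def x by auto
    have "(3 * p + 1 + 3 * q) div 3 = p + q" "(3 * p + 1 + 3 * q) mod 3 = 1" by presburger+
    then show "?f (3 * p + 1) (3 * q) = Some ?y"
      unfolding config_def strips_def using nd pq by simp
    have "(3 * p + (3 * q + 1)) div 3 = p + q" "(3 * p + (3 * q + 1)) mod 3 = 1" by presburger+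
    then show "?f (3 * p) (3 * q + 1) = Some ?y"
      unfolding config_def strips_def using nd pq by simp
    have "(3 * p + 1 + (3 * q + 1)) div 3 = p + q" "(3 * p + 1 + (3 * q + 1)) mod 3 = 2" by presburger+
    then show "?f (3 * p + 1) (3 * q + 1) = Some ?y"
      unfolding config_def strips_def using nd pq by simp
    have "(3 * p - 1 + 3 * q) div 3 = p + q - 1" by presburger
    then show "?f (3 * p - 1) (3 * q) \<noteq> Some ?y"
      unfolding config_def strips_def grid_def using nd pq by auto
    have "(3 * p + (3 * q - 1)) div 3 = p + q - 1" by presburger
    then show "?f (3 * p) (3 * q - 1) \<noteq> Some ?y"
      unfolding config_def strips_def grid_def using nd pq by auto
    have "(3 * p - 1 + (3 * q - 1)) div 3 = p + q - 1" by presburger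
    then show "?f (3 * p - 1) (3 * q - 1) \<noteq> Some ?y"
      unfolding config_def strips_def grid_def using nd pq by auto
  qed
  moreover have "spherical ?f" using insert.IH insert.prems by blast
  ultimately show ?case by simp
qed

section \<open>Counting\<close>

text \<open>Taking \<open>K = 2 * H\<close> ensures \<open>p + q < K\<close> on the whole
  \<open>H\<close> by \<open>H\<close> square. A row and a column beyond the strips stay untouched,
  so no path vertex disappears.\<close>

locale configuration =
  fixes K H m n :: nat and S :: "(int \<times> int) set"
  assumes K: "K = 2 * H" and m: "3 * K + 1 \<le> m" and n: "3 * K + 1 \<le> n"
    and S: "S \<subseteq> {0..<int H} \<times> {0..<int H}"
begin

abbreviation conf :: "int \<Rightarrow> int \<Rightarrow> nat option" where
  "conf \<equiv> config K (int m) (int n) S"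

lemma spherical_conf: "spherical conf"
proof (rule spherical_config)
  show "finite S" using S finite_subset by blast
qed (use S K m n in auto)

lemma conf_inside:
  assumes "conf i j \<noteq> Some 0"
  shows "0 \<le> i \<and> i < int m \<and> 0 \<le> j \<and> j < int n"
proof -
  consider "3 dvd i" "3 dvd j" "(i div 3, j div 3) \<in> S"
    | "0 \<le> i" "0 \<le> j" "(i + j) div 3 < int K"
    | "0 \<le> i \<and> i < int m \<and> 0 \<le> j \<and> j < int n"
    using assms unfolding config_def strips_def grid_def by (auto split: if_splits)
  then show ?thesis
  proof cases
    case 1
    then have "0 \<le> i div 3" "i div 3 < int H" "0 \<le> j div 3" "j div 3 < int H" using S by auto
    then show ?thesis using K m n by auto
  next
    case 2
    then have "i + j < 3 * int K" by linarith
    then show ?thesis using 2 m n by auto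
  qed
qed

lemma conf_le:
  assumes "conf i j = Some y"
  shows "y \<le> K"
proof -
  have "nat ((i + j) div 3) + 1 \<le> K" if "3 dvd i" "3 dvd j" "(i div 3, j div 3) \<in> S"
  proof -
    have "0 \<le> i div 3" "i div 3 < int H" "0 \<le> j div 3" "j div 3 < int H" using S that by auto
    moreover have "(i + j) div 3 = i div 3 + j div 3" using that by auto
    ultimately show ?thesis using K by linarith
  qed
  moreover have "nat ((i + j) div 3) + 1 \<le> K" if "0 \<le> i" "0 \<le> j" "(i + j) div 3 < int K"
    using that by linarith
  ultimately show ?thesis
    using assms unfolding config_def strips_def grid_def by (simp split: if_splits)
qed

lemma conf_far:
  assumes "0 \<le> i" "i < int m" "0 \<le> j" "j < int n" "3 * int K \<le> i \<or> 3 * int K \<le> j"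
  shows "conf i j = None"
proof -
  have "(i div 3, j div 3) \<notin> S"
  proof
    assume "(i div 3, j div 3) \<in> S"
    then have "i div 3 < int H" "j div 3 < int H" using S by auto
    then show False using K assms(5) by linarith
  qed
  moreover have "\<not> (i + j) div 3 < int K" using assms by linarith
  ultimately show ?thesis using assms unfolding config_def strips_def grid_def by auto
qed

lemma conf_outside: "conf (- 1) j = Some 0"
proof -
  have "\<not> 3 dvd (- 1 :: int)" by presburger
  then show ?thesis unfolding config_def strips_def grid_def by auto
qed

text \<open>The vertex set is independent of \<open>S\<close>, so all configurations can be counted
  on one common vertex set.\<close>

lemma vertices_conf: "\<Union> (facets conf) = VA ` {0..int m} \<union> VB ` {0..int n} \<union> VO ` {0..K}"
  (is "_ = ?V")
proof (intro subset_antisym subsetI)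
  fix v assume "v \<in> \<Union> (facets conf)"
  then obtain F where v: "v \<in> F" and "F \<in> facets conf" by blast
  from this(2) have "F \<subseteq> ?V"
  proof (cases rule: facetsE)
    case (tet i j)
    then show ?thesis using conf_inside[of i j] by (auto simp: tet_def)
  next
    case (htri y i j)
    then have "y \<le> K" using conf_le by metis
    moreover have "conf (i - 1) j \<noteq> Some 0 \<or> conf i j \<noteq> Some 0" using htri(2) by (cases "y = 0") auto
    then have "0 \<le> i \<and> i \<le> int m \<and> 0 \<le> j \<and> j < int n"
      using conf_inside[of "i - 1" j] conf_inside[of i j] by auto
    ultimately show ?thesis using htri(1) by (auto simp: htri_def)
  next
    case (vtri y i j)
    then have "y \<le> K" using conf_le by metis
    moreover have "conf i (j - 1) \<noteq> Some 0 \<or> conf i j \<noteq> Some 0" using vtri(2) by (cases "y = 0") auto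
    then have "0 \<le> i \<and> i < int m \<and> 0 \<le> j \<and> j \<le> int n"
      using conf_inside[of i "j - 1"] conf_inside[of i j] by auto
    ultimately show ?thesis using vtri(1) by (auto simp: vtri_def)
  qed
  with v show "v \<in> ?V" by blast
next
  fix v assume "v \<in> ?V"
  then consider i where "v = VA i" "0 \<le> i" "i \<le> int m" | j where "v = VB j" "0 \<le> j" "j \<le> int n"
    | "v = VO 0" | k where "v = VO (Suc k)" "k < K"
    by (auto simp: image_iff) (metis Suc_le_eq not0_implies_Suc)
  then show "v \<in> \<Union> (facets conf)"
  proof cases
    case 1
    \<comment> \<open>The last row is untouched. The minimum handles the end vertex
      \<open>VA m\<close>, which has no cell to its right.\<close>
    have "tet (min i (int m - 1)) (int n - 1) \<in> facets conf"
      using 1 m n by (simp add: conf_far)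
    moreover have "v \<in> tet (min i (int m - 1)) (int n - 1)" using 1 by auto
    ultimately show ?thesis by blast
  next
    case 2
    have "tet (int m - 1) (min j (int n - 1)) \<in> facets conf"
      using 2 m n by (simp add: conf_far)
    moreover have "v \<in> tet (int m - 1) (min j (int n - 1))" using 2 by auto
    ultimately show ?thesis by blast
  next
    case 3
    have "insert (VO 0) (htri 0 (int n - 1)) \<in> facets conf"
      using m n by (simp add: conf_far conf_outside)
    then show ?thesis using 3 by blast
  next
    case (4 k)
    \<comment> \<open>The cell \<open>(0, 3 * k + 1)\<close> lies in strip \<open>k\<close> and its
      left neighbour is outside, so the triangle between them is coned from
      \<open>VO (Suc k)\<close>.\<close>
    have "\<not> 3 dvd (3 * int k + 1)" "(3 * int k + 1) div 3 = int k" "(3 * int k + 1) mod 3 \<noteq> 0"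
      by presburger+
    then have "conf 0 (3 * int k + 1) = Some (Suc k)"
      using 4 unfolding config_def strips_def by simp
    then have "insert (VO (Suc k)) (htri 0 (3 * int k + 1)) \<in> facets conf"
      by (simp add: conf_outside)
    then show ?thesis using 4 by blast
  qed
qed

lemma card_vertices_conf: "card (\<Union> (facets conf)) = m + n + K + 3"
proof -
  have "card (VA ` {0..int m} \<union> VB ` {0..int n} \<union> VO ` {0..K})
    = card (VA ` {0..int m}) + card (VB ` {0..int n}) + card (VO ` {0..K})"
    by (subst card_Un_disjoint; (subst card_Un_disjoint)?; auto)
  also have "\<dots> = m + n + K + 3"
    by (simp add: card_image inj_on_def)
  finally show ?thesis unfolding vertices_conf .
qed

text \<open>The complex remembers \<open>S\<close>: cone facets have only three path vertices, so a
  cell is a face exactly when it is not absorbed, and a cell on a diagonal divisible by 3 can be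
  absorbed only through \<open>S\<close>.\<close>

lemma tet_face_conf_iff:
  assumes "(p, q) \<in> {0..<int H} \<times> {0..<int H}"
  shows "tet (3 * p) (3 * q) \<in> faces (facets conf) \<longleftrightarrow> (p, q) \<notin> S"
proof -
  have "(\<exists>F\<in>facets conf. tet i j \<subseteq> F) \<longleftrightarrow> conf i j = None" for i j
  proof
    assume "\<exists>F\<in>facets conf. tet i j \<subseteq> F"
    then obtain F where F: "F \<in> facets conf" and "tet i j \<subseteq> F" by blast
    then have "VA i \<in> F" "VA (i + 1) \<in> F" "VB j \<in> F" "VB (j + 1) \<in> F" by auto
    then show "conf i j = None" using F by (elim facetsE) auto
  qed (meson mem_facets(1) order_refl)
  then have "tet (3 * p) (3 * q) \<in> faces (facets conf) \<longleftrightarrow> conf (3 * p) (3 * q) = None"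
    unfolding faces_def tet_def by auto
  moreover have "(3 * p + 3 * q) mod 3 = 0" by presburger
  ultimately show ?thesis
    using assms K m n unfolding config_def strips_def grid_def by auto
qed

end

section \<open>Transfer to vertices in \<open>nat\<close> and counting up to isomorphism\<close>

instance vert :: countable by countable_datatype

lemma sphere3_triangulation_relabel:
  fixes g :: "vert \<Rightarrow> 'b"
  assumes "spherical f" "inj g" and fin: "finite (\<Union> (facets f))"
  shows "sphere3_triangulation (card (\<Union> (facets f))) (faces ((`) g ` facets f))"
proof -
  have F: "\<forall>F\<in>facets f. finite F" using fin by (meson Sup_upper finite_subset)
  have U: "\<Union> ((`) g ` facets f) = g ` \<Union> (facets f)" by blast
  note h = geometric_realization_relabel[OF \<open>inj g\<close> F]
  have "geometric_realization (faces ((`) g ` facets f)) homeomorphic sphere (0 :: real ^ 4) 1"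
    using homeomorphic_trans[OF iffD1[OF homeomorphic_sym h]] assms(1) unfolding spherical_def by blast
  moreover have "card (g ` \<Union> (facets f)) = card (\<Union> (facets f))"
    using \<open>inj g\<close> by (meson card_image inj_on_subset subset_UNIV)
  ultimately show ?thesis
    unfolding sphere3_triangulation_def vertices_faces U
    using finite_abstract_complex_faces[of "(`) g ` facets f"] fin U by simp
qed

text \<open>Extending the vertex bijection by the identity outside \<open>V\<close> gives a
  permutation, so isomorphic complexes on \<open>V\<close> share an orbit of the symmetric
  group.\<close>

lemma isomorphic_imp_permuted:
  assumes "complex_isomorphic K L" "vertices K = V" "vertices L = V"
  obtains f where "f permutes V" "L = (`) f ` K" "K = (`) (inv f) ` L"
proof -
  obtain h where h: "bij_betw h V V" "\<And>\<sigma>. \<sigma> \<subseteq> V \<Longrightarrow> \<sigma> \<in> K \<longleftrightarrow> h ` \<sigma> \<in> L"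
    using assms unfolding complex_isomorphic_def by auto
  define f where "f = (\<lambda>x. if x \<in> V then h x else x)"
  have "bij_betw f V V" using h(1) unfolding f_def by (simp cong: bij_betw_cong)
  then have f: "f permutes V" by (intro bij_imp_permutes) (auto simp: f_def)
  have fh: "f ` \<sigma> = h ` \<sigma>" if "\<sigma> \<subseteq> V" for \<sigma> using that unfolding f_def by auto
  have KV: "\<sigma> \<subseteq> V" if "\<sigma> \<in> K \<or> \<sigma> \<in> L" for \<sigma> using that assms(2,3) unfolding vertices_def by auto
  have inv: "inv f ` f ` \<sigma> = \<sigma>" "f ` inv f ` \<sigma> = \<sigma>" for \<sigma>
    using f by (simp_all add: image_comp permutes_inv_o)
  have "inv f ` \<tau> \<in> K" if "\<tau> \<in> L" for \<tau>
  proof -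
    have "inv f ` \<tau> \<subseteq> V" using permutes_inv[OF f] KV that by (metis image_mono permutes_image)
    then show ?thesis using h(2) fh inv(2)[of \<tau>] that by metis
  qed
  moreover have "f ` \<sigma> \<in> L" if "\<sigma> \<in> K" for \<sigma> using h(2) fh KV that by metis
  ultimately have "L = (`) f ` K" "K = (`) (inv f) ` L"
    using inv by (auto simp: image_iff) (metis inv)+
  with f that show ?thesis by blast
qed

text \<open>For a maximal pairwise non-isomorphic subfamily \<open>T\<close>, the orbits of its
  members cover the family, and each orbit has at most \<open>fact (card V)\<close>
  elements.\<close>

lemma card_le_fact_times_nonisomorphic:
  assumes "finite \<F>" "finite V" "\<And>K. K \<in> \<F> \<Longrightarrow> vertices K = V"
  obtains T where "T \<subseteq> \<F>" "pairwise (\<lambda>K L. \<not> complex_isomorphic K L) T"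
    "card \<F> \<le> card T * fact (card V)"
proof -
  \<comment> \<open>Both directions of isomorphism occur because \<open>pairwise\<close> tests
    ordered pairs.\<close>
  have "\<exists>T\<subseteq>\<F>. pairwise (\<lambda>K L. \<not> complex_isomorphic K L) T \<and>
    (\<forall>K\<in>\<F>. \<exists>L\<in>T. K = L \<or> complex_isomorphic K L \<or> complex_isomorphic L K)"
    using assms(1)
  proof (induction \<F>)
    case (insert K \<F>)
    then obtain T where T: "T \<subseteq> \<F>" "pairwise (\<lambda>K L. \<not> complex_isomorphic K L) T"
      "\<forall>K\<in>\<F>. \<exists>L\<in>T. K = L \<or> complex_isomorphic K L \<or> complex_isomorphic L K" by blast
    show ?case
    proof (cases "\<exists>L\<in>T. complex_isomorphic K L \<or> complex_isomorphic L K")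
      case True
      then show ?thesis using T by (intro exI[of _ T]) blast
    next
      case False
      then show ?thesis using T by (intro exI[of _ "insert K T"]) (auto simp: pairwise_insert)
    qed
  qed simp
  then obtain T where T: "T \<subseteq> \<F>" "pairwise (\<lambda>K L. \<not> complex_isomorphic K L) T"
    and max: "\<And>K. K \<in> \<F> \<Longrightarrow> \<exists>L\<in>T. K = L \<or> complex_isomorphic K L \<or> complex_isomorphic L K" by blast
  let ?orbit = "\<lambda>L. (\<lambda>f. (`) f ` L) ` {f. f permutes V}"
  have "\<F> \<subseteq> (\<Union>L\<in>T. ?orbit L)"
  proof
    fix K assume K: "K \<in> \<F>"
    then obtain L where L: "L \<in> T" and KL: "K = L \<or> complex_isomorphic K L \<or> complex_isomorphic L K"
      using max by blast
    have v: "vertices K = V" "vertices L = V" using assms(3) K L T(1) by auto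
    have "\<exists>f. f permutes V \<and> K = (`) f ` L"
      using KL
    proof (elim disjE)
      assume "K = L"
      then show ?thesis using permutes_id[of V] by (intro exI[of _ id]) simp
    next
      assume "complex_isomorphic K L"
      then show ?thesis using isomorphic_imp_permuted[OF _ v] permutes_inv by metis
    next
      assume "complex_isomorphic L K"
      then show ?thesis using isomorphic_imp_permuted[OF _ v(2,1)] by metis
    qed
    then show "K \<in> (\<Union>L\<in>T. ?orbit L)" using L by blast
  qed
  moreover have finT: "finite T" using T(1) assms(1) finite_subset by blast
  moreover have fin: "finite {f. f permutes V}" using assms(2) by (rule finite_permutations)
  ultimately have "card \<F> \<le> card (\<Union>L\<in>T. ?orbit L)" by (intro card_mono) auto
  also have "\<dots> \<le> (\<Sum>L\<in>T. card (?orbit L))" using finT by (rule card_UN_le)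
  also have "\<dots> \<le> (\<Sum>L\<in>T. fact (card V))"
    using card_image_le[OF fin] assms(2) by (intro sum_mono) (simp add: card_permutations[OF refl])
  finally show ?thesis using that T by simp
qed

lemma many_triangulations:
  assumes "14 * H + 5 \<le> N"
  shows "\<exists>T :: nat set set set. finite T \<and> (\<forall>K\<in>T. sphere3_triangulation N K) \<and>
    pairwise (\<lambda>K L. \<not> complex_isomorphic K L) T \<and> 2 ^ (H\<^sup>2) \<le> card T * fact N"
proof -
  \<comment> \<open>With \<open>K = 2 * H\<close> and first path length \<open>6 * H + 1\<close>,
    all vertices but the count \<open>n\<close> number \<open>8 * H + 4\<close>. The bound on
    \<open>N\<close> gives \<open>n \<ge> 6 * H + 1\<close>, as the configuration requires.\<close>
  define n where "n = N - (8 * H + 4)"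
  define Q where "Q = {0..<int H} \<times> {0..<int H}"
  define f where "f = config (2 * H) (int (6 * H + 1)) (int n)"
  define C :: "(int \<times> int) set \<Rightarrow> nat set set" where
    "C S = faces ((`) to_nat ` facets (f S))" for S
  have conf: "configuration (2 * H) H (6 * H + 1) n S" if "S \<subseteq> Q" for S
    using that assms unfolding Q_def n_def by unfold_locales auto
  have N: "6 * H + 1 + n + 2 * H + 3 = N" using assms unfolding n_def by simp
  define V where "V = (to_nat :: vert \<Rightarrow> nat) ` (VA ` {0..int (6 * H + 1)} \<union> VB ` {0..int n} \<union> VO ` {0..2 * H})"
  have V: "vertices (C S) = V" "sphere3_triangulation N (C S)" if S: "S \<in> Pow Q" for S
  proof -
    interpret configuration "2 * H" H "6 * H + 1" n S using conf S by blast
    have U: "\<Union> (facets (f S)) = VA ` {0..int (6 * H + 1)} \<union> VB ` {0..int n} \<union> VO ` {0..2 * H}"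
      unfolding f_def by (rule vertices_conf)
    then have fin: "finite (\<Union> (facets (f S)))" by simp
    show "vertices (C S) = V"
      unfolding C_def vertices_faces V_def U[symmetric] by blast
    have "card (\<Union> (facets (f S))) = N"
      unfolding f_def card_vertices_conf using N by simp
    then show "sphere3_triangulation N (C S)"
      using sphere3_triangulation_relabel[OF _ inj_to_nat fin] spherical_conf
      unfolding C_def f_def by simp
  qed
  have "inj_on C (Pow Q)"
  proof (rule inj_onI)
    fix S S' assume S: "S \<in> Pow Q" "S' \<in> Pow Q" and eq: "C S = C S'"
    \<comment> \<open>\<open>S\<close> is read off from \<open>C S\<close> by testing which
      selectable cells are no longer faces.\<close>
    have "x \<in> S \<longleftrightarrow> to_nat ` tet (3 * fst x) (3 * snd x) \<notin> C S" if "S \<in> Pow Q" "x \<in> Q" for S x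
    proof -
      interpret configuration "2 * H" H "6 * H + 1" n S using conf that by blast
      obtain p q where x: "x = (p, q)" by fastforce
      have "to_nat ` \<sigma> \<in> C S \<longleftrightarrow> \<sigma> \<in> faces (facets (f S))" for \<sigma>
        unfolding C_def faces_def by (auto simp: inj_image_subset_iff)
      then show ?thesis
        using tet_face_conf_iff[of p q] that(2) unfolding x f_def Q_def by simp
    qed
    from this[OF S(1)] this[OF S(2)] show "S = S'" using S eq by blast
  qed
  moreover have "card (Pow Q) = 2 ^ H\<^sup>2"
    unfolding Q_def by (simp add: card_Pow card_cartesian_product power2_eq_square)
  ultimately have card: "card (C ` Pow Q) = 2 ^ H\<^sup>2" by (simp add: card_image)
  have finV: "finite V" unfolding V_def by simp
  have "card V = N"
    using V[of "{}"] unfolding sphere3_triangulation_def by simp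
  moreover have finC: "finite (C ` Pow Q)" unfolding Q_def by simp
  have VC: "vertices K = V" if "K \<in> C ` Pow Q" for K using that V(1) by blast
  obtain T where T: "T \<subseteq> C ` Pow Q" "pairwise (\<lambda>K L. \<not> complex_isomorphic K L) T"
    "card (C ` Pow Q) \<le> card T * fact (card V)"
    using card_le_fact_times_nonisomorphic[OF finC finV VC] .
  moreover have "finite T" using finite_subset[OF T(1) finC] .
  moreover have "\<forall>K\<in>T. sphere3_triangulation N K" using T(1) V(2) by blast
  ultimately show ?thesis using card by (intro exI[of _ T]) simp
qed

section \<open>Choice of constants and the asymptotic bound\<close>

theorem corollary1p2:
  "\<exists>c::real. c > 0 \<and>
     (\<exists>n0::nat. \<forall>n\<ge>n0. \<exists>T :: nat set set set.
        finite T \<and>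
        (\<forall>K\<in>T. sphere3_triangulation n K) \<and>
        pairwise (\<lambda>K L. \<not> complex_isomorphic K L) T \<and>
        real (card T) \<ge> 2 powr (c * (real n)\<^sup>2))"
proof -
  \<comment> \<open>Half of the exponent \<open>(real n)\<^sup>2 / 1600\<close> is spent on
    \<open>fact n\<close>, which is at most \<open>n ^ n\<close> and hence eventually at most 2 to
    the power \<open>(real n)\<^sup>2 / 3200\<close>.\<close>
  have "eventually (\<lambda>n. ln (real n) / real n < ln 2 / 3200) sequentially"
    using lim_ln_over_n by (rule order_tendstoD) simp
  then obtain n1 where n1: "\<And>n. n \<ge> n1 \<Longrightarrow> ln (real n) / real n < ln 2 / 3200"
    unfolding eventually_sequentially by blast
  have "\<exists>T :: nat set set set. finite T \<and> (\<forall>K\<in>T. sphere3_triangulation n K) \<and>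
    pairwise (\<lambda>K L. \<not> complex_isomorphic K L) T \<and> real (card T) \<ge> 2 powr (1 / 3200 * (real n)\<^sup>2)"
    if n: "n \<ge> max n1 40" for n
  proof -
    \<comment> \<open>From \<open>n \<ge> 40\<close> follows \<open>H \<ge> 2\<close>, hence
      \<open>14 * H + 5 \<le> 20 * H \<le> n\<close> and
      \<open>n < 20 * H + 20 \<le> 40 * H\<close>.\<close>
    define H where "H = n div 20"
    have "14 * H + 5 \<le> n" "n \<le> 40 * H" using n unfolding H_def by linarith+
    obtain T :: "nat set set set" where T: "finite T" "\<forall>K\<in>T. sphere3_triangulation n K"
      "pairwise (\<lambda>K L. \<not> complex_isomorphic K L) T" "2 ^ (H\<^sup>2) \<le> card T * fact n"
      using many_triangulations[OF \<open>14 * H + 5 \<le> n\<close>] by blast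
    have npos: "0 < real n" using n by simp
    have "(real n)\<^sup>2 \<le> (40 * real H)\<^sup>2" using \<open>n \<le> 40 * H\<close> by (intro power_mono) linarith+
    then have "(real n)\<^sup>2 / 1600 \<le> real (H\<^sup>2)" by (simp add: power_mult_distrib)
    then have "2 powr ((real n)\<^sup>2 / 1600) \<le> 2 powr real (H\<^sup>2)" by (intro powr_mono) auto
    also have "\<dots> = real (2 ^ (H\<^sup>2))" by (simp add: powr_realpow del: of_nat_power)
    also have "\<dots> \<le> real (card T * fact n)" using T(4) by (simp only: of_nat_le_iff)
    also have "\<dots> \<le> real (card T) * real n ^ n"
    proof -
      have "fact n \<le> real n ^ n" using fact_le_power[of n, where 'a = real] by simp
      then show ?thesis unfolding of_nat_mult of_nat_fact by (intro mult_left_mono) simp_all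
    qed
    also have "real n ^ n \<le> 2 powr (1 / 3200 * (real n)\<^sup>2)"
    proof -
      have "ln (real n) \<le> ln 2 / 3200 * real n" using n1[of n] n npos by (simp add: field_simps)
      then have "real n * ln (real n) \<le> real n * (ln 2 / 3200 * real n)" by (intro mult_left_mono) auto
      then have "exp (real n * ln (real n)) \<le> exp (1 / 3200 * (real n)\<^sup>2 * ln 2)"
        by (simp add: power2_eq_square algebra_simps)
      then show ?thesis using npos by (simp add: powr_def exp_of_nat_mult)
    qed
    finally have "2 powr ((real n)\<^sup>2 / 1600) \<le> real (card T) * 2 powr (1 / 3200 * (real n)\<^sup>2)"
      by (simp add: mult_left_mono)
    moreover have "2 powr ((real n)\<^sup>2 / 1600) = 2 powr (1 / 3200 * (real n)\<^sup>2) * 2 powr (1 / 3200 * (real n)\<^sup>2)"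
      by (simp flip: powr_add)
    ultimately have "2 powr (1 / 3200 * (real n)\<^sup>2) \<le> real (card T)" by simp
    with T show ?thesis by blast
  qed
  then show ?thesis
    by (intro exI[of _ "1 / 3200 :: real"] conjI exI[of _ "max n1 40"] allI impI) simp_all
qed

end
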